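(* Let $\Xi$ be the transformation of $K$ (the $\mathbb{C}$-algebra homomorphism determined by its values on the variables) defined by $$\Xi:(\nu_1,\dots,\nu_8;\kappa_1,\kappa_2;f,g)\mapsto\Bigl(\tfrac{\nu_5\nu_6}{\kappa_2}\nu_1,\tfrac{\nu_5\nu_6}{\kappa_2}\nu_2,\tfrac{\nu_5\nu_6}{\kappa_2}\nu_3,\tfrac{\nu_5\nu_6}{\kappa_2}\nu_4,\tfrac{\kappa_1}{q\kappa_2}\nu_5,\tfrac{\kappa_1}{q\kappa_2}\nu_6,\tfrac{\kappa_1}{q\nu_7\nu_8}\nu_7,\tfrac{\kappa_1}{q\nu_7\nu_8}\nu_8;\ \tfrac{\kappa_1\nu_5\nu_6}{q\kappa_2\nu_7\nu_8}\kappa_1,\tfrac{\kappa_1\nu_5\nu_6}{q\kappa_2^2}\kappa_2;\ \tfrac{\nu_5\nu_6}{\kappa_2}f,\tfrac{\kappa_2}{\nu_5\nu_6}g\Bigr),$$ and set $T=\Xi\cdot(\pi_1\pi_2s_4s_5s_3s_6s_4s_3s_0s_6)^2$. Then $T$ coincides with the time evolution of the $q$-Painlevé equation $q$-$P(E_6^{(1)})$, i.e. $T(\nu_i)=\nu_i$ $(1\le i\le 8)$, $T(\kappa_1)=\kappa_1/q$, $T(\kappa_2)=q\kappa_2$, $T(q)=q$, and $T(f)=\overline f$, $T(g)=\overline g$. Moreover $\Xi$ is within the equivalence of the parameters of type $E_6^{(1)}$, i.e. $$(\Xi(\nu_1),\dots,\Xi(\nu_8);\Xi(\kappa_1),\X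i(\kappa_2);\Xi(f),\Xi(g))\sim(\nu_1,\dots,\nu_8;\kappa_1,\kappa_2;f,g).$$
   Context: Let $K=\mathbb{C}(\nu_1,\dots,\nu_8,\kappa_1,\kappa_2,f,g)$ be the field of rational functions in 12 independent variables, and put $q=\kappa_1^2\kappa_2^2/(\nu_1\nu_2\cdots\nu_8)\in K$ (i.e. $\kappa_1^2\kappa_2^2=q\,\nu_1\cdots\nu_8$). Products of transformations are compositions of maps of $K$: $(w_1w_2)(\varphi)=w_1(w_2(\varphi))$ for $\varphi\in K$. Action of the generators of the extended affine Weyl group $\widetilde W(E_6^{(1)})$: the following are $\mathbb{C}$-algebra automorphisms of $K$; variables not mentioned are fixed. - $s_0:\nu_7\leftrightarrow\nu_8$; $s_1:\nu_5\leftrightarrow\nu_6$; $s_3:\nu_1\leftrightarrow\nu_2$; $s_4:\nu_2\leftrightarrow\nu_3$; $s_5:\nu_3\leftrightarrow\nu_4$. - $s_2:\ \nu_1\to\frac{\kappa_2}{\nu_6},\ \nu_6\to\frac{\kappa_2}{\nu_1},\ \kappa_1\to\frac{\kappa_1\kappa_2}{\nu_1\nu_6},\ f\to f\,\frac{\kappa_2(\nu_1 g-1)}{(\nu_1\nu_6-\kappa_2)fg+\nu_1\kappa_2 g-\nu_1\nu_6}$. - $s_6:\ \nu_1\to\frac{\kappa_1}{\nu_7},\ \nu_7\to\frac{\kappa_1}{\nu_1},\ \kappa_2\to\frac{\kappa_1\kappa_2}{\nu_1\nu_7},\ g\to g\,\frac{\nu_7(\nu_1-f)}{\kappa_1-\nu_7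 f+(\nu_1\nu_7-\kappa_1)fg}$. - $\pi_1:\ \nu_1\to\nu_2/\kappa_2,\ \nu_2\to\nu_1/\kappa_2,\ \nu_3\to1/\nu_6,\ \nu_4\to1/\nu_5,\ \nu_5\to1/\nu_4,\ \nu_6\to1/\nu_3,\ \nu_7\to1/\nu_7,\ \nu_8\to1/\nu_8,\ \kappa_1\to\nu_1\nu_2/(\kappa_1\kappa_2),\ \kappa_2\to1/\kappa_2,\ f\to\frac{\nu_1\nu_2(1-fg)}{\kappa_2\{\nu_1\nu_2 g+f-(\nu_1+\nu_2)fg\}},\ g\to\kappa_2 g$ (and $q\to1/q$). - $\pi_2:\ \nu_i\to1/\nu_i\ (i=1,2,3,4),\ \nu_5\to1/\nu_8,\ \nu_6\to1/\nu_7,\ \nu_7\to1/\nu_6,\ \nu_8\to1/\nu_5,\ \kappa_1\to1/\kappa_2,\ \kappa_2\to1/\kappa_1,\ f\leftrightarrow g$ (and $q\to1/q$). Time evolution of $q$-$P(E_6^{(1)})$: the transformation $\varphi\mapsto\overline\varphi$ of $K$ (with inverse $\varphi\mapsto\underline\varphi$) with $\overline{\nu_i}=\nu_i$, $\overline{\kappa_1}=\kappa_1/q$, $\overline{\kappa_2}=q\kappa_2$, $\overline q=q$, and with $\overline f,\underline g$ determined by $$\frac{(fg-1)(\overline f g-1)}{f\overline f}=\frac{(g-1/\nu_1)(g-1/\nu_2)(g-1/\nu_3)(g-1/\nu_4)}{(g-\nu_5/\kappa_2)(g-\nu_6/\kappa_2)},$$ $$\frac{(fg-1)(f\underline g-1)}{g\underline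 g}=\frac{(f-\nu_1)(f-\nu_2)(f-\nu_3)(f-\nu_4)}{(f-\kappa_1/\nu_7)(f-\kappa_1/\nu_8)}.$$ Applying the time evolution to the second equation, $\overline g$ is determined by $$\frac{(\overline f g-1)(\overline f\,\overline g-1)}{g\overline g}=\frac{(\overline f-\nu_1)(\overline f-\nu_2)(\overline f-\nu_3)(\overline f-\nu_4)}{(\overline f-\kappa_1/(q\nu_7))(\overline f-\kappa_1/(q\nu_8))}.$$ Equivalence of type $E_6^{(1)}$: two tuples $y'$ and $y=(\nu_1,\dots,\nu_8;\kappa_1,\kappa_2;f,g)$ with entries in $K$ satisfy $y'\sim y$ iff there exist $a,b,c\in K\setminus\{0\}$ such that $$y'=(a\nu_1,a\nu_2,a\nu_3,a\nu_4,b\nu_5,b\nu_6,c\nu_7,c\nu_8;\ ac\,\kappa_1,\ ab\,\kappa_2;\ af,\ g/a).$$ *)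

theory Defs
  imports
    Complex_Main
    "HOL-Library.Poly_Mapping"
    "HOL-Computational_Algebra.Fraction_Field"
begin

section \<open>The field of rational functions in 12 variables\<close>

datatype var = N1 | N2 | N3 | N4 | N5 | N6 | N7 | N8 | K1 | K2 | F | G

text \<open>The linear order below has no meaning of its own: the library proves that a polynomial ring is
  an integral domain only for linearly ordered sets of variables.\<close>

fun var_index :: "var \<Rightarrow> nat" where
  "var_index N1 = 1" | "var_index N2 = 2" | "var_index N3 = 3" | "var_index N4 = 4"
| "var_index N5 = 5" | "var_index N6 = 6" | "var_index N7 = 7" | "var_index N8 = 8"
| "var_index K1 = 9" | "var_index K2 = 10" | "var_index F = 11" | "var_index G = 12"

lemma var_index_inject: "var_index x = var_index y \<Longrightarrow> x = y"
  by (cases x; cases y) simp_all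

instantiation var :: linorder
begin

definition less_eq_var :: "var \<Rightarrow> var \<Rightarrow> bool" where
  "x \<le> y \<longleftrightarrow> var_index x \<le> var_index y"

definition less_var :: "var \<Rightarrow> var \<Rightarrow> bool" where
  "x < y \<longleftrightarrow> var_index x < var_index y"

instance
  by standard (auto simp: less_eq_var_def less_var_def intro: var_index_inject)

end

lemma UNIV_var: "UNIV = {N1, N2, N3, N4, N5, N6, N7, N8, K1, K2, F, G}"
  using var.exhaust by blast

instance var :: finite
  by standard (simp add: UNIV_var)

text \<open>\<open>pol\<close> is the polynomial ring \<open>\<complex>[\<nu>\<^sub>1, \<dots>, \<nu>\<^sub>8, \<kappa>\<^sub>1, \<kappa>\<^sub>2, f, g]\<close> (finitely supported maps from exponent
  vectors to coefficients, with the convolution product), \<open>K\<close> is its fraction field.\<close>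

type_synonym pol = "(var \<Rightarrow>\<^sub>0 nat) \<Rightarrow>\<^sub>0 complex"
type_synonym K = "pol fract"

definition const :: "complex \<Rightarrow> K" where
  "const c = Fract (Poly_Mapping.single 0 c) 1"

definition gen :: "var \<Rightarrow> K" where
  "gen v = Fract (Poly_Mapping.single (Poly_Mapping.single v 1) 1) 1"

abbreviation "nu1 \<equiv> gen N1"
abbreviation "nu2 \<equiv> gen N2"
abbreviation "nu3 \<equiv> gen N3"
abbreviation "nu4 \<equiv> gen N4"
abbreviation "nu5 \<equiv> gen N5"
abbreviation "nu6 \<equiv> gen N6"
abbreviation "nu7 \<equiv> gen N7"
abbreviation "nu8 \<equiv> gen N8"
abbreviation "kappa1 \<equiv> gen K1"
abbreviation "kappa2 \<equiv> gen K2"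
abbreviation "f \<equiv> gen F"
abbreviation "g \<equiv> gen G"

definition q :: K where
  "q = kappa1^2 * kappa2^2 / (nu1 * nu2 * nu3 * nu4 * nu5 * nu6 * nu7 * nu8)"


section \<open>Transformations\<close>

definition alg_hom :: "(K \<Rightarrow> K) \<Rightarrow> bool" where
  "alg_hom \<phi> \<longleftrightarrow>
     (\<forall>x y. \<phi> (x + y) = \<phi> x + \<phi> y) \<and>
     (\<forall>x y. \<phi> (x * y) = \<phi> x * \<phi> y) \<and>
     (\<forall>c. \<phi> (const c) = const c)"

definition alg_aut :: "(K \<Rightarrow> K) \<Rightarrow> bool" where
  "alg_aut \<phi> \<longleftrightarrow> alg_hom \<phi> \<and> bij \<phi>"

text \<open>The \<open>\<complex>\<close>-algebra homomorphism with prescribed values on the variables.  It is unique if it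
  exists (\<open>alg_hom_unique\<close>); for all instances used below it does exist and is an automorphism
  (\<open>alg_aut_generators\<close>, \<open>alg_aut_Xi\<close>).\<close>

definition hom_of :: "(var \<Rightarrow> K) \<Rightarrow> K \<Rightarrow> K" where
  "hom_of h = (THE \<phi>. alg_hom \<phi> \<and> (\<forall>v. \<phi> (gen v) = h v))"

definition "s0_val = gen(N7 := nu8, N8 := nu7)"
definition "s1_val = gen(N5 := nu6, N6 := nu5)"
definition "s2_val = gen(
  N1 := kappa2 / nu6,
  N6 := kappa2 / nu1,
  K1 := kappa1 * kappa2 / (nu1 * nu6),
  F := f * (kappa2 * (nu1 * g - 1)
         / ((nu1 * nu6 - kappa2) * f * g + nu1 * kappa2 * g - nu1 * nu6)))"
definition "s3_val = gen(N1 := nu2, N2 := nu1)"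
definition "s4_val = gen(N2 := nu3, N3 := nu2)"
definition "s5_val = gen(N3 := nu4, N4 := nu3)"
definition "s6_val = gen(
  N1 := kappa1 / nu7,
  N7 := kappa1 / nu1,
  K2 := kappa1 * kappa2 / (nu1 * nu7),
  G := g * (nu7 * (nu1 - f) / (kappa1 - nu7 * f + (nu1 * nu7 - kappa1) * f * g)))"
definition "pi1_val = gen(
  N1 := nu2 / kappa2,
  N2 := nu1 / kappa2,
  N3 := 1 / nu6,
  N4 := 1 / nu5,
  N5 := 1 / nu4,
  N6 := 1 / nu3,
  N7 := 1 / nu7,
  N8 := 1 / nu8,
  K1 := nu1 * nu2 / (kappa1 * kappa2),
  K2 := 1 / kappa2,
  F := nu1 * nu2 * (1 - f * g) / (kappa2 * (nu1 * nu2 * g + f - (nu1 + nu2) * f * g)),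
  G := kappa2 * g)"
definition "pi2_val = gen(
  N1 := 1 / nu1,
  N2 := 1 / nu2,
  N3 := 1 / nu3,
  N4 := 1 / nu4,
  N5 := 1 / nu8,
  N6 := 1 / nu7,
  N7 := 1 / nu6,
  N8 := 1 / nu5,
  K1 := 1 / kappa2,
  K2 := 1 / kappa1,
  F := g,
  G := f)"
definition "Xi_val = gen(
  N1 := nu5 * nu6 / kappa2 * nu1,
  N2 := nu5 * nu6 / kappa2 * nu2,
  N3 := nu5 * nu6 / kappa2 * nu3,
  N4 := nu5 * nu6 / kappa2 * nu4,
  N5 := kappa1 / (q * kappa2) * nu5,
  N6 := kappa1 / (q * kappa2) * nu6,
  N7 := kappa1 / (q * nu7 * nu8) * nu7,
  N8 := kappa1 / (q * nu7 * nu8) * nu8,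
  K1 := kappa1 * nu5 * nu6 / (q * kappa2 * nu7 * nu8) * kappa1,
  K2 := kappa1 * nu5 * nu6 / (q * kappa2^2) * kappa2,
  F := nu5 * nu6 / kappa2 * f,
  G := kappa2 / (nu5 * nu6) * g)"

definition "s0 = hom_of s0_val"
definition "s1 = hom_of s1_val"
definition "s2 = hom_of s2_val"
definition "s3 = hom_of s3_val"
definition "s4 = hom_of s4_val"
definition "s5 = hom_of s5_val"
definition "s6 = hom_of s6_val"
definition "pi1 = hom_of pi1_val"
definition "pi2 = hom_of pi2_val"
definition "Xi = hom_of Xi_val"

definition T :: "K \<Rightarrow> K" where
  "T = Xi \<circ> (pi1 \<circ> pi2 \<circ> s4 \<circ> s5 \<circ> s3 \<circ> s6 \<circ> s4 \<circ> s3 \<circ> s0 \<circ> s6) ^^ 2"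


section \<open>Time evolution and equivalence\<close>

text \<open>In the two equations \<open>\<phi> f\<close> is \<open>f\<close> with an overline and \<open>inv \<phi> g\<close> is \<open>g\<close> with an underline.  All
  denominators are nonzero, as \<open>\<phi>\<close> is an automorphism.\<close>

definition is_time_evolution :: "(K \<Rightarrow> K) \<Rightarrow> bool" where
  "is_time_evolution \<phi> \<longleftrightarrow>
     alg_aut \<phi> \<and>
     (\<forall>v \<in> {N1, N2, N3, N4, N5, N6, N7, N8}. \<phi> (gen v) = gen v) \<and>
     \<phi> kappa1 = kappa1 / q \<and>
     \<phi> kappa2 = q * kappa2 \<and>
     \<phi> q = q \<and>
     (f * g - 1) * (\<phi> f * g - 1) / (f * \<phi> f) =
       (g - 1 / nu1) * (g - 1 / nu2) * (g - 1 / nu3) * (g - 1 / nu4)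
         / ((g - nu5 / kappa2) * (g - nu6 / kappa2)) \<and>
     (f * g - 1) * (f * inv \<phi> g - 1) / (g * inv \<phi> g) =
       (f - nu1) * (f - nu2) * (f - nu3) * (f - nu4)
         / ((f - kappa1 / nu7) * (f - kappa1 / nu8))"

definition time_evolution :: "K \<Rightarrow> K" where
  "time_evolution = (THE \<phi>. is_time_evolution \<phi>)"

definition equiv_E6 :: "(var \<Rightarrow> K) \<Rightarrow> (var \<Rightarrow> K) \<Rightarrow> bool" where
  "equiv_E6 y' y \<longleftrightarrow> (\<exists>a b c. a \<noteq> 0 \<and> b \<noteq> 0 \<and> c \<noteq> 0 \<and>
     (\<forall>v \<in> {N1, N2, N3, N4}. y' v = a * y v) \<and>
     (\<forall>v \<in> {N5, N6}. y' v = b * y v) \<and>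
     (\<forall>v \<in> {N7, N8}. y' v = c * y v) \<and>
     y' K1 = a * c * y K1 \<and>
     y' K2 = a * b * y K2 \<and>
     y' F = a * y F \<and>
     y' G = y G / a)"


section \<open>The transformations are well defined\<close>

definition peval :: "(complex \<Rightarrow> 'b::field) \<Rightarrow> (var \<Rightarrow> 'b) \<Rightarrow> pol \<Rightarrow> 'b" where
  "peval c h p = (\<Sum>m\<in>Poly_Mapping.keys p.
     c (Poly_Mapping.lookup p m) * (\<Prod>v\<in>UNIV. h v ^ Poly_Mapping.lookup m v))"

definition scalar_hom :: "(complex \<Rightarrow> 'b::field) \<Rightarrow> bool" where
  "scalar_hom c \<longleftrightarrow> c 1 = 1 \<and> (\<forall>x y. c (x + y) = c x + c y) \<and> (\<forall>x y. c (x * y) = c x * c y)"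

lemma scalar_hom_0: "scalar_hom c \<Longrightarrow> c 0 = 0"
  unfolding scalar_hom_def by (metis add_cancel_right_left)

lemma scalar_hom_minus: "scalar_hom c \<Longrightarrow> c (- x) = - c x"
  using scalar_hom_0[of c] unfolding scalar_hom_def by (metis add.right_inverse add_eq_0_iff)

lemma scalar_hom_const: "scalar_hom const"
  unfolding scalar_hom_def const_def
  by (auto simp: One_fract_def Poly_Mapping.mult_single Poly_Mapping.single_add)

lemma scalar_hom_id: "scalar_hom (\<lambda>x::complex. x)"
  by (simp add: scalar_hom_def)

lemma sum_monomials:
  "p = (\<Sum>m\<in>Poly_Mapping.keys p. Poly_Mapping.single m (Poly_Mapping.lookup p m))"
  by (rule poly_mapping_eqI) (simp add: lookup_sum lookup_single when_def in_keys_iff)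

lemma peval_superset:
  assumes "scalar_hom c" "finite A" "Poly_Mapping.keys p \<subseteq> A"
  shows "peval c h p = (\<Sum>m\<in>A. c (Poly_Mapping.lookup p m) * (\<Prod>v\<in>UNIV. h v ^ Poly_Mapping.lookup m v))"
  unfolding peval_def using assms
  by (intro sum.mono_neutral_left) (auto simp: in_keys_iff scalar_hom_0)

lemma peval_add:
  assumes "scalar_hom c"
  shows "peval c h (p + r) = peval c h p + peval c h r"
proof -
  let ?A = "Poly_Mapping.keys p \<union> Poly_Mapping.keys r"
  have "Poly_Mapping.keys (p + r) \<subseteq> ?A" by (rule Poly_Mapping.keys_add)
  then show ?thesis
    using assms by (simp add: peval_superset[where A = ?A] Poly_Mapping.lookup_add scalar_hom_def
        distrib_right sum.distrib)
qed

lemma peval_single: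
  assumes "scalar_hom c"
  shows "peval c h (Poly_Mapping.single m x) = c x * (\<Prod>v\<in>UNIV. h v ^ Poly_Mapping.lookup m v)"
  using assms by (subst peval_superset[where A = "{m}"]) auto

lemma peval_sum:
  assumes "scalar_hom c" "finite A"
  shows "peval c h (sum P A) = (\<Sum>x\<in>A. peval c h (P x))"
  using assms(2)
proof (induction A rule: finite_induct)
  case empty
  then show ?case by (simp add: peval_def)
next
  case (insert x F)
  then show ?case by (simp add: peval_add[OF assms(1)])
qed

lemma peval_mult:
  assumes "scalar_hom c"
  shows "peval c h (p * r) = peval c h p * peval c h r"
proof -
  have m: "peval c h (Poly_Mapping.single m x * Poly_Mapping.single n y) =
      peval c h (Poly_Mapping.single m x) * peval c h (Poly_Mapping.single n y)" for m x n y
    using assms by (simp add: Poly_Mapping.mult_single peval_single Poly_Mapping.lookup_add power_add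
        prod.distrib scalar_hom_def)
  have d: "p = (\<Sum>m\<in>Poly_Mapping.keys p. Poly_Mapping.single m (Poly_Mapping.lookup p m))"
    "r = (\<Sum>m\<in>Poly_Mapping.keys r. Poly_Mapping.single m (Poly_Mapping.lookup r m))"
    by (rule sum_monomials)+
  show ?thesis
    by (subst (1 2) d(1), subst (1 2) d(2))
      (simp add: sum_product peval_sum[OF assms] m)
qed

lemma peval_0: "peval c h 0 = 0"
  by (simp add: peval_def)

lemma peval_const: "scalar_hom c \<Longrightarrow> peval c h (Poly_Mapping.single 0 x) = c x"
  by (simp add: peval_single)

lemma peval_1: "scalar_hom c \<Longrightarrow> peval c h 1 = 1"
  by (metis peval_const scalar_hom_def single_one)

lemma peval_var:
  assumes "scalar_hom c"
  shows "peval c h (Poly_Mapping.single (Poly_Mapping.single v 1) 1) = h v"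
proof -
  have "(\<Prod>w\<in>UNIV. h w ^ Poly_Mapping.lookup (Poly_Mapping.single v (1::nat)) w) =
      (\<Prod>w\<in>UNIV. if v = w then h w else 1)"
    by (intro prod.cong refl) (auto simp: lookup_single)
  then show ?thesis using assms by (simp add: peval_single scalar_hom_def)
qed

lemma peval_uminus:
  assumes "scalar_hom c"
  shows "peval c h (- p) = - peval c h p"
  by (metis add.right_inverse add_eq_0_iff assms peval_0 peval_add)

text \<open>\<open>has_value c h x y\<close>: the rational function \<open>x\<close> is regular at the point \<open>h\<close>, with value \<open>y\<close>.\<close>

definition has_value :: "(complex \<Rightarrow> 'b::field) \<Rightarrow> (var \<Rightarrow> 'b) \<Rightarrow> K \<Rightarrow> 'b \<Rightarrow> bool" where
  "has_value c h x y \<longleftrightarrow>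
     (\<exists>p r. x = Fract p r \<and> peval c h r \<noteq> 0 \<and> y = peval c h p / peval c h r)"

context
  fixes c :: "complex \<Rightarrow> 'b::field" and h :: "var \<Rightarrow> 'b"
  assumes c: "scalar_hom c"
begin

lemma nz: "peval c h r \<noteq> 0 \<Longrightarrow> r \<noteq> 0"
  using peval_0 by blast

lemma has_value_const: "has_value c h (const x) (c x)"
  unfolding has_value_def const_def using peval_const[OF c] peval_1[OF c]
  by (intro exI[of _ "Poly_Mapping.single 0 x"] exI[of _ 1]) simp

lemma has_value_0: "has_value c h 0 0"
  unfolding has_value_def by (intro exI[of _ 0] exI[of _ 1]) (simp add: Zero_fract_def peval_0 peval_1[OF c])

lemma has_value_1: "has_value c h 1 1"
  unfolding has_value_def by (intro exI[of _ 1] exI[of _ 1]) (simp add: One_fract_def peval_1[OF c])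

lemma has_value_gen: "has_value c h (gen v) (h v)"
  unfolding has_value_def gen_def
  by (intro exI[of _ "Poly_Mapping.single (Poly_Mapping.single v 1) 1"] exI[of _ 1])
    (simp add: peval_var[OF c, simplified] peval_1[OF c])

lemma has_value_add:
  assumes "has_value c h x y" "has_value c h x' y'"
  shows "has_value c h (x + x') (y + y')"
proof -
  obtain p r where 1: "x = Fract p r" "peval c h r \<noteq> 0" "y = peval c h p / peval c h r"
    using assms(1) unfolding has_value_def by auto
  obtain p' r' where 2: "x' = Fract p' r'" "peval c h r' \<noteq> 0" "y' = peval c h p' / peval c h r'"
    using assms(2) unfolding has_value_def by auto
  show ?thesis unfolding has_value_def
    using 1 2 nz[OF 1(2)] nz[OF 2(2)]
    by (intro exI[of _ "p * r' + p' * r"] exI[of _ "r * r'"])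
      (simp add: peval_mult[OF c] peval_add[OF c] add_frac_eq)
qed

lemma has_value_mult:
  assumes "has_value c h x y" "has_value c h x' y'"
  shows "has_value c h (x * x') (y * y')"
proof -
  obtain p r where 1: "x = Fract p r" "peval c h r \<noteq> 0" "y = peval c h p / peval c h r"
    using assms(1) unfolding has_value_def by auto
  obtain p' r' where 2: "x' = Fract p' r'" "peval c h r' \<noteq> 0" "y' = peval c h p' / peval c h r'"
    using assms(2) unfolding has_value_def by auto
  show ?thesis unfolding has_value_def
    using 1 2
    by (intro exI[of _ "p * p'"] exI[of _ "r * r'"]) (simp add: peval_mult[OF c])
qed

lemma has_value_uminus:
  assumes "has_value c h x y"
  shows "has_value c h (- x) (- y)"
proof -
  obtain p r where 1: "x = Fract p r" "peval c h r \<noteq> 0" "y = peval c h p / peval c h r"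
    using assms(1) unfolding has_value_def by auto
  show ?thesis unfolding has_value_def using 1
    by (intro exI[of _ "- p"] exI[of _ r]) (simp add: peval_uminus[OF c])
qed

lemma has_value_diff:
  assumes "has_value c h x y" "has_value c h x' y'"
  shows "has_value c h (x - x') (y - y')"
  using has_value_add[OF assms(1) has_value_uminus[OF assms(2)]] by simp

lemma has_value_inverse:
  assumes "has_value c h x y" "y \<noteq> 0"
  shows "has_value c h (inverse x) (inverse y)"
proof -
  obtain p r where 1: "x = Fract p r" "peval c h r \<noteq> 0" "y = peval c h p / peval c h r"
    using assms(1) unfolding has_value_def by auto
  show ?thesis unfolding has_value_def using 1 assms(2)
    by (intro exI[of _ r] exI[of _ p]) simp
qed

lemma has_value_divide:
  assumes "has_value c h x y" "has_value c h x' y'" "y' \<noteq> 0"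
  shows "has_value c h (x / x') (y / y')"
  using has_value_mult[OF assms(1) has_value_inverse[OF assms(2,3)]] by (simp add: divide_inverse)

lemma has_value_power:
  assumes "has_value c h x y"
  shows "has_value c h (x ^ n) (y ^ n)"
  by (induction n) (auto intro: has_value_1 has_value_mult assms)

lemma has_value_unique:
  assumes "has_value c h x y" "has_value c h x y'"
  shows "y = y'"
proof -
  obtain p r where 1: "x = Fract p r" "peval c h r \<noteq> 0" "y = peval c h p / peval c h r"
    using assms(1) unfolding has_value_def by auto
  obtain p' r' where 2: "x = Fract p' r'" "peval c h r' \<noteq> 0" "y' = peval c h p' / peval c h r'"
    using assms(2) unfolding has_value_def by auto
  have "p * r' = p' * r" using 1 2 nz[OF 1(2)] nz[OF 2(2)] by (simp add: eq_fract)
  then have "peval c h p * peval c h r' = peval c h p' * peval c h r"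
    by (metis peval_mult[OF c])
  then show ?thesis using 1(2) 2(2) unfolding 1(3) 2(3) by (simp add: frac_eq_eq)
qed

lemma has_value_nonzero: "has_value c h x y \<Longrightarrow> y \<noteq> 0 \<Longrightarrow> x \<noteq> 0"
  using has_value_0 has_value_unique by blast

lemmas has_value_intros = has_value_0 has_value_1 has_value_gen has_value_add has_value_mult
  has_value_diff has_value_divide has_value_power

end

lemma Fract_divide: "Fract p r = Fract p 1 / Fract r (1 :: 'a :: idom)"
  by simp

lemma pol_induct [case_names const var add mult]:
  assumes "\<And>x. P (Poly_Mapping.single 0 x)"
    and "\<And>v. P (Poly_Mapping.single (Poly_Mapping.single v 1) 1)"
    and "\<And>p r. P p \<Longrightarrow> P r \<Longrightarrow> P (p + r)" "\<And>p r. P p \<Longrightarrow> P r \<Longrightarrow> P (p * r)"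
  shows "P (p :: pol)"
proof -
  have one: "P 1" using assms(1)[of 1] by simp
  have zero: "P 0" using assms(1)[of 0] by simp
  have vp: "P (Poly_Mapping.single (Poly_Mapping.single v n) 1)" for v n
  proof (induction n)
    case 0
    then show ?case using one by simp
  next
    case (Suc n)
    have "Poly_Mapping.single (Poly_Mapping.single v (Suc n)) (1::complex) =
      Poly_Mapping.single (Poly_Mapping.single v 1) 1 * Poly_Mapping.single (Poly_Mapping.single v n) 1"
      by (simp add: Poly_Mapping.mult_single flip: Poly_Mapping.single_add)
    then show ?case using assms(2,4) Suc by metis
  qed
  have mon: "P (Poly_Mapping.single (\<Sum>v\<in>A. Poly_Mapping.single v (e v)) 1)" if "finite A" for A and e :: "var \<Rightarrow> nat"
    using that
  proof (induction A rule: finite_induct)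
    case empty
    then show ?case using one by simp
  next
    case (insert v A)
    have "Poly_Mapping.single (\<Sum>v\<in>insert v A. Poly_Mapping.single v (e v)) (1::complex) =
       Poly_Mapping.single (Poly_Mapping.single v (e v)) 1 * Poly_Mapping.single (\<Sum>v\<in>A. Poly_Mapping.single v (e v)) 1"
      using insert by (simp add: Poly_Mapping.mult_single)
    then show ?case using vp insert assms(4) by metis
  qed
  have monom: "P (Poly_Mapping.single m x)" for m x
  proof -
    have "Poly_Mapping.single m x = Poly_Mapping.single 0 x *
        Poly_Mapping.single (\<Sum>v\<in>Poly_Mapping.keys m. Poly_Mapping.single v (Poly_Mapping.lookup m v)) 1"
      by (simp add: Poly_Mapping.mult_single flip: sum_monomials)
    then show ?thesis using mon[of "Poly_Mapping.keys m" "Poly_Mapping.lookup m"] assms(1,4) by (metis finite_keys)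
  qed
  have "P (\<Sum>m\<in>A. Poly_Mapping.single m (Poly_Mapping.lookup p m))" if "finite A" for A
    using that by (induction A rule: finite_induct) (auto intro: monom zero assms(3))
  then show ?thesis using sum_monomials[of p] by (metis finite_keys)
qed

lemma alg_hom_has_value:
  assumes "alg_hom \<phi>" "\<And>v. \<phi> (gen v) = h v" "has_value const h x y"
  shows "\<phi> x = y"
proof -
  have A: "\<phi> (u + v) = \<phi> u + \<phi> v" "\<phi> (u * v) = \<phi> u * \<phi> v" "\<phi> (const k) = const k" for u v k
    using assms(1) unfolding alg_hom_def by auto
  have P: "\<phi> (Fract p 1) = peval const h p" for p
  proof (induction p rule: pol_induct)
    case (const x)
    show ?case using A(3)[of x] unfolding peval_const[OF scalar_hom_const] by (simp add: const_def)
  next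
    case (var v)
    show ?case using assms(2)[of v] unfolding peval_var[OF scalar_hom_const] by (simp add: gen_def)
  next
    case (add p r)
    then show ?case using A(1)[of "Fract p 1" "Fract r 1"] by (simp add: peval_add[OF scalar_hom_const])
  next
    case (mult p r)
    then show ?case using A(2)[of "Fract p 1" "Fract r 1"] by (simp add: peval_mult[OF scalar_hom_const])
  qed
  obtain p r where 1: "x = Fract p r" "peval const h r \<noteq> 0" "y = peval const h p / peval const h r"
    using assms(3) unfolding has_value_def by auto
  have "r \<noteq> 0" using 1(2) peval_0 by blast
  then have "Fract p 1 = x * Fract r 1" using 1 by (simp add: eq_fract)
  then have "peval const h p = \<phi> x * peval const h r" using A(2) P by metis
  then show ?thesis using 1 by simp
qed

lemma alg_hom_unique:
  assumes "alg_hom \<phi>" "alg_hom \<psi>" "\<And>v. \<phi> (gen v) = \<psi> (gen v)"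
  shows "\<phi> = \<psi>"
proof
  fix x
  have inj: "\<theta> u \<noteq> 0" if "alg_hom \<theta>" "u \<noteq> 0" for \<theta> u
  proof
    assume "\<theta> u = 0"
    then have "\<theta> (u * inverse u) = 0" using that(1) unfolding alg_hom_def by (metis mult_zero_left)
    moreover have "\<theta> 1 = 1" using that scalar_hom_const unfolding alg_hom_def scalar_hom_def by metis
    ultimately show False using that by simp
  qed
  define h where "h = (\<lambda>v. \<phi> (gen v))"
  obtain p r :: pol where x: "x = Fract p r" "r \<noteq> 0" by (cases x rule: Fract_cases)
  have *: "has_value const h (Fract r 1) (peval const h r)"
    unfolding has_value_def by (intro exI[of _ r] exI[of _ 1]) (simp add: peval_1[OF scalar_hom_const])
  have "\<phi> (Fract r 1) = peval const h r"
    by (rule alg_hom_has_value[OF assms(1) _ *]) (simp add: h_def)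
  moreover have "Fract r 1 \<noteq> 0" using x by (simp add: Zero_fract_def eq_fract)
  ultimately have "peval const h r \<noteq> 0" using inj assms(1) by metis
  then have v: "has_value const h x (peval const h p / peval const h r)" using x unfolding has_value_def by blast
  show "\<phi> x = \<psi> x"
    using alg_hom_has_value[OF assms(1) _ v] alg_hom_has_value[OF assms(2) _ v] assms(3) by (simp add: h_def)
qed

lemma hom_of_eq:
  assumes "alg_hom \<phi>" "\<And>v. \<phi> (gen v) = h v"
  shows "hom_of h = \<phi>"
  unfolding hom_of_def using assms alg_hom_unique by (intro the_equality) (blast, metis)

lemma hom_of_left_inverse:
  assumes "\<And>v. has_value const k (h v) (gen v)"
  shows "alg_hom (hom_of h)" and "hom_of h (gen v) = h v"
proof -
  note S = scalar_hom_const
  have L: "has_value const k (peval const h p) (Fract p 1)" for p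
  proof (induction p rule: pol_induct)
    case (const x)
    have "const x = Fract (Poly_Mapping.single 0 x) 1" by (simp add: const_def)
    then show ?case using has_value_const[OF S, of k x] by (simp add: peval_const[OF S])
  next
    case (var v)
    show ?case using assms[of v] unfolding peval_var[OF S] by (simp add: gen_def)
  next
    case (add p r)
    show ?case using has_value_add[OF S add] by (simp add: peval_add[OF S])
  next
    case (mult p r)
    show ?case using has_value_mult[OF S mult] by (simp add: peval_mult[OF S])
  qed
  have nz: "peval const h r \<noteq> 0" if "r \<noteq> 0" for r
  proof (rule has_value_nonzero[OF S L])
    show "Fract r 1 \<noteq> 0" using that by (simp add: Zero_fract_def eq_fract)
  qed
  have ex: "\<exists>y. has_value const h x y" for x
  proof -
    obtain p r :: pol where "x = Fract p r" "r \<noteq> 0" by (cases x rule: Fract_cases)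
    then show ?thesis using nz unfolding has_value_def by blast
  qed
  define \<phi> where "\<phi> = (\<lambda>x. SOME y. has_value const h x y)"
  have \<phi>: "has_value const h x (\<phi> x)" for x unfolding \<phi>_def using ex by (rule someI_ex)
  have \<phi>eq: "\<phi> x = y" if "has_value const h x y" for x y
    using has_value_unique[OF S \<phi> that] .
  have hom: "alg_hom \<phi>"
    unfolding alg_hom_def
    by (intro conjI allI \<phi>eq has_value_add[OF S] has_value_mult[OF S] has_value_const[OF S] \<phi>)
  have val: "\<phi> (gen v) = h v" for v by (rule \<phi>eq[OF has_value_gen[OF S]])
  show "alg_hom (hom_of h)" "hom_of h (gen v) = h v" using hom_of_eq[OF hom val] hom val by auto
qed

lemma alg_hom_id: "alg_hom (\<lambda>x. x)"
  by (simp add: alg_hom_def)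

lemma alg_hom_comp: "alg_hom \<phi> \<Longrightarrow> alg_hom \<psi> \<Longrightarrow> alg_hom (\<lambda>x. \<phi> (\<psi> x))"
  by (simp add: alg_hom_def)

lemma hom_of_aut:
  assumes 1: "\<And>v. has_value const k (h v) (gen v)" and 2: "\<And>v. has_value const h (k v) (gen v)"
  shows "alg_aut (hom_of h)" and "hom_of h (gen v) = h v"
proof -
  note H = hom_of_left_inverse[OF 1] and K = hom_of_left_inverse[OF 2]
  have l: "hom_of k (hom_of h (gen v)) = gen v" for v
    using alg_hom_has_value[OF K(1) K(2) 1[of v]] by (simp add: H(2))
  have r: "hom_of h (hom_of k (gen v)) = gen v" for v
    using alg_hom_has_value[OF H(1) H(2) 2[of v]] by (simp add: K(2))
  have "(\<lambda>x. hom_of k (hom_of h x)) = (\<lambda>x. x)"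
    by (rule alg_hom_unique[OF alg_hom_comp[OF K(1) H(1)] alg_hom_id l])
  moreover have "(\<lambda>x. hom_of h (hom_of k x)) = (\<lambda>x. x)"
    by (rule alg_hom_unique[OF alg_hom_comp[OF H(1) K(1)] alg_hom_id r])
  ultimately have "bij (hom_of h)"
    by (intro o_bij[of "hom_of k"]) (simp_all add: fun_eq_iff)
  then show "alg_aut (hom_of h)" "hom_of h (gen v) = h v" using H unfolding alg_aut_def by auto
qed


lemma has_value_eq: "has_value c h x y \<Longrightarrow> y = z \<Longrightarrow> has_value c h x z"
  by simp

lemma gen_nonzero [simp]: "gen v \<noteq> 0"
  by (rule has_value_nonzero[OF scalar_hom_id has_value_gen[OF scalar_hom_id], where h = "\<lambda>_. 1"]) simp

lemma q_nonzero [simp]: "q \<noteq> 0"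
  by (simp add: q_def)

lemmas value_intros = has_value_intros[OF scalar_hom_const]
lemmas point_intros = has_value_intros[OF scalar_hom_id]

lemma denom_nonzero:
  shows "(nu1 * nu6 - kappa2) * f * g + nu1 * kappa2 * g - nu1 * nu6 \<noteq> 0"
    and "nu1 * g - 1 \<noteq> 0" and "kappa2 * g - nu6 \<noteq> 0"
    and "kappa1 - nu7 * f + (nu1 * nu7 - kappa1) * f * g \<noteq> 0"
    and "nu1 - f \<noteq> 0" and "kappa1 - nu7 * f \<noteq> 0"
    and "nu1 * nu2 * g + f - (nu1 + nu2) * f * g \<noteq> 0"
    and "1 - f * g \<noteq> 0" and "nu2 - f \<noteq> 0" and "nu2 * g - 1 \<noteq> 0"
  by - (rule has_value_nonzero[OF scalar_hom_id, where h = "(\<lambda>_. 2)(N6 := 3, K2 := 5, N7 := 3, K1 := 7, F := 11, G := 13)"],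
      (rule point_intros)+, simp)+

lemma swap_aut:
  assumes "h = gen(a := gen b, b := gen a)"
  shows "alg_aut (hom_of h)" and "hom_of h (gen v) = h v"
proof -
  have "has_value const h (h v) (gen v)" for v
  proof -
    have "h v = gen ((id(a := b, b := a)) v)" by (simp add: assms)
    then have "has_value const h (h v) (h ((id(a := b, b := a)) v))"
      using value_intros(3) by metis
    then show ?thesis by (simp add: assms split: if_splits)
  qed
  then show "alg_aut (hom_of h)" "hom_of h (gen v) = h v" using hom_of_aut by blast+
qed

lemma s2_denom:
  assumes "a \<noteq> 0" "b \<noteq> 0" "l \<noteq> 0" "(a * b - l) * x * y + a * l * y - a * b \<noteq> 0"
  shows "((l / b) * (l / a) - l) * (x * (l * (a * y - 1) / ((a * b - l) * x * y + a * l * y - a * b))) * y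
    + (l / b) * l * y - (l / b) * (l / a)
      = l^2 * (a * y - 1) * (l * y - b) / (b * ((a * b - l) * x * y + a * l * y - (a::K) * b))"
  using assms by (simp add: divide_simps) (simp add: algebra_simps power2_eq_square)

lemma s6_denom:
  assumes "a \<noteq> 0" "b \<noteq> 0" "k \<noteq> 0" "k - b * x + (a * b - k) * x * y \<noteq> 0"
  shows "k - k / a * x + (k / b * (k / a) - k) * x * (y * (b * (a - x) / (k - b * x + (a * b - k) * x * y)))
      = k * (a - x) * (k - b * x) / (a * (k - b * x + ((a::K) * b - k) * x * y))"
  using assms by (simp add: divide_simps) (simp add: algebra_simps power2_eq_square)

lemma pi1_denom:
  assumes "a \<noteq> 0" "b \<noteq> 0" "l \<noteq> 0" "a * b * y + x - (a + b) * x * y \<noteq> 0"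
  shows "b / l * (a / l) * (l * y) + a * b * (1 - x * y) / (l * (a * b * y + x - (a + b) * x * y))
      - (b / l + a / l) * (a * b * (1 - x * y) / (l * (a * b * y + x - (a + b) * x * y))) * (l * y)
      = a * b * (a * y - 1) * (b * y - 1) / (l * (a * b * y + x - ((a::K) + b) * x * y))"
    and "1 - a * b * (1 - x * y) / (l * (a * b * y + x - (a + b) * x * y)) * (l * y)
      = x * (a * y - 1) * (b * y - 1) / (a * b * y + x - ((a::K) + b) * x * y)"
  using assms by (simp add: divide_simps, simp add: algebra_simps power2_eq_square)+

lemma s2_value:
  assumes "a \<noteq> 0" "b \<noteq> 0" "l \<noteq> 0" "d \<noteq> 0" "a * y - 1 \<noteq> 0" "l * y - b \<noteq> 0"
  shows "x * (l * (a * y - 1) / d) * (l * (l / b * y - 1) / (l^2 * (a * y - 1) * (l * y - b) / (b * (d::K)))) = x"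
proof -
  have "l / b * y - 1 = (l * y - b) / b" using assms by (simp add: divide_simps)
  then show ?thesis using assms by (simp add: power2_eq_square)
qed

lemma s6_value:
  assumes "a \<noteq> 0" "b \<noteq> 0" "k \<noteq> 0" "d \<noteq> 0" "a - x \<noteq> 0" "k - b * x \<noteq> 0"
  shows "y * (b * (a - x) / d) * (k / a * (k / b - x) / (k * (a - x) * (k - b * x) / (a * (d::K)))) = y"
proof -
  have "k / b - x = (k - b * x) / b" using assms by (simp add: divide_simps)
  then show ?thesis using assms by simp
qed

lemma pi1_value:
  assumes "a \<noteq> 0" "b \<noteq> 0" "l \<noteq> 0" "d \<noteq> 0" "a * y - 1 \<noteq> 0" "b * y - 1 \<noteq> 0"
  shows "b / l * (a / l) * (x * (a * y - 1) * (b * y - 1) / d)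
    / (1 / l * (a * b * (a * y - 1) * (b * y - 1) / (l * (d::K)))) = x"
  using assms by simp

definition "Xi_inv_val = gen(
  N1 := nu1 / (kappa1 / (q * nu7 * nu8)),
  N2 := nu2 / (kappa1 / (q * nu7 * nu8)),
  N3 := nu3 / (kappa1 / (q * nu7 * nu8)),
  N4 := nu4 / (kappa1 / (q * nu7 * nu8)),
  N5 := nu5 / (nu5 * nu6 / kappa2),
  N6 := nu6 / (nu5 * nu6 / kappa2),
  N7 := nu7 / (kappa1 / (q * kappa2)),
  N8 := nu8 / (kappa1 / (q * kappa2)),
  K1 := kappa1 / (kappa1 / (q * kappa2) * (kappa1 / (q * nu7 * nu8))),
  K2 := kappa2 / (kappa1 / (q * nu7 * nu8) * (nu5 * nu6 / kappa2)),
  F := f / (kappa1 / (q * nu7 * nu8)),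
  G := g * (kappa1 / (q * nu7 * nu8)))"

lemma s2_val_simps:
  "s2_val N1 = kappa2 / nu6"
  "s2_val N2 = nu2"
  "s2_val N3 = nu3"
  "s2_val N4 = nu4"
  "s2_val N5 = nu5"
  "s2_val N6 = kappa2 / nu1"
  "s2_val N7 = nu7"
  "s2_val N8 = nu8"
  "s2_val K1 = kappa1 * kappa2 / (nu1 * nu6)"
  "s2_val K2 = kappa2"
  "s2_val F = f * (kappa2 * (nu1 * g - 1) / ((nu1 * nu6 - kappa2) * f * g + nu1 * kappa2 * g - nu1 * nu6))"
  "s2_val G = g"
  by (simp_all add: s2_val_def)

lemma s6_val_simps:
  "s6_val N1 = kappa1 / nu7"
  "s6_val N2 = nu2"
  "s6_val N3 = nu3"
  "s6_val N4 = nu4"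
  "s6_val N5 = nu5"
  "s6_val N6 = nu6"
  "s6_val N7 = kappa1 / nu1"
  "s6_val N8 = nu8"
  "s6_val K1 = kappa1"
  "s6_val K2 = kappa1 * kappa2 / (nu1 * nu7)"
  "s6_val F = f"
  "s6_val G = g * (nu7 * (nu1 - f) / (kappa1 - nu7 * f + (nu1 * nu7 - kappa1) * f * g))"
  by (simp_all add: s6_val_def)

lemma pi1_val_simps:
  "pi1_val N1 = nu2 / kappa2"
  "pi1_val N2 = nu1 / kappa2"
  "pi1_val N3 = 1 / nu6"
  "pi1_val N4 = 1 / nu5"
  "pi1_val N5 = 1 / nu4"
  "pi1_val N6 = 1 / nu3"
  "pi1_val N7 = 1 / nu7"
  "pi1_val N8 = 1 / nu8"
  "pi1_val K1 = nu1 * nu2 / (kappa1 * kappa2)"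
  "pi1_val K2 = 1 / kappa2"
  "pi1_val F = nu1 * nu2 * (1 - f * g) / (kappa2 * (nu1 * nu2 * g + f - (nu1 + nu2) * f * g))"
  "pi1_val G = kappa2 * g"
  by (simp_all add: pi1_val_def)

lemma pi2_val_simps:
  "pi2_val N1 = 1 / nu1"
  "pi2_val N2 = 1 / nu2"
  "pi2_val N3 = 1 / nu3"
  "pi2_val N4 = 1 / nu4"
  "pi2_val N5 = 1 / nu8"
  "pi2_val N6 = 1 / nu7"
  "pi2_val N7 = 1 / nu6"
  "pi2_val N8 = 1 / nu5"
  "pi2_val K1 = 1 / kappa2"
  "pi2_val K2 = 1 / kappa1"
  "pi2_val F = g"
  "pi2_val G = f"
  by (simp_all add: pi2_val_def)

lemma Xi_val_simps:
  "Xi_val N1 = nu5 * nu6 / kappa2 * nu1"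
  "Xi_val N2 = nu5 * nu6 / kappa2 * nu2"
  "Xi_val N3 = nu5 * nu6 / kappa2 * nu3"
  "Xi_val N4 = nu5 * nu6 / kappa2 * nu4"
  "Xi_val N5 = kappa1 / (q * kappa2) * nu5"
  "Xi_val N6 = kappa1 / (q * kappa2) * nu6"
  "Xi_val N7 = kappa1 / (q * nu7 * nu8) * nu7"
  "Xi_val N8 = kappa1 / (q * nu7 * nu8) * nu8"
  "Xi_val K1 = kappa1 * nu5 * nu6 / (q * kappa2 * nu7 * nu8) * kappa1"
  "Xi_val K2 = kappa1 * nu5 * nu6 / (q * kappa2^2) * kappa2"
  "Xi_val F = nu5 * nu6 / kappa2 * f"
  "Xi_val G = kappa2 / (nu5 * nu6) * g"
  by (simp_all add: Xi_val_def)

lemma Xi_inv_val_simps: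
  "Xi_inv_val N1 = nu1 / (kappa1 / (q * nu7 * nu8))"
  "Xi_inv_val N2 = nu2 / (kappa1 / (q * nu7 * nu8))"
  "Xi_inv_val N3 = nu3 / (kappa1 / (q * nu7 * nu8))"
  "Xi_inv_val N4 = nu4 / (kappa1 / (q * nu7 * nu8))"
  "Xi_inv_val N5 = nu5 / (nu5 * nu6 / kappa2)"
  "Xi_inv_val N6 = nu6 / (nu5 * nu6 / kappa2)"
  "Xi_inv_val N7 = nu7 / (kappa1 / (q * kappa2))"
  "Xi_inv_val N8 = nu8 / (kappa1 / (q * kappa2))"
  "Xi_inv_val K1 = kappa1 / (kappa1 / (q * kappa2) * (kappa1 / (q * nu7 * nu8)))"
  "Xi_inv_val K2 = kappa2 / (kappa1 / (q * nu7 * nu8) * (nu5 * nu6 / kappa2))"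
  "Xi_inv_val F = f / (kappa1 / (q * nu7 * nu8))"
  "Xi_inv_val G = g * (kappa1 / (q * nu7 * nu8))"
  by (simp_all add: Xi_inv_val_def)

lemma s2_inverse: "has_value const s2_val (s2_val v) (gen v)"
  apply (cases v; simp only: s2_val_simps; rule has_value_eq)
  apply (rule value_intros | (unfold s2_val_simps s2_denom[OF gen_nonzero gen_nonzero gen_nonzero denom_nonzero(1)], rule s2_value[OF gen_nonzero gen_nonzero gen_nonzero denom_nonzero(1,2,3)])
      | (unfold s2_val_simps s2_denom[OF gen_nonzero gen_nonzero gen_nonzero denom_nonzero(1)], insert denom_nonzero, simp; fail)
      | (simp add: s2_val_simps denom_nonzero s2_denom; fail)
      | (simp add: s2_val_simps denom_nonzero s2_denom field_simps; fail)
      | (simp add: s2_val_simps denom_nonzero s2_denom divide_simps, simp add: algebra_simps power2_eq_square; fail))+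
  done

lemma s6_inverse: "has_value const s6_val (s6_val v) (gen v)"
  apply (cases v; simp only: s6_val_simps; rule has_value_eq)
  apply (rule value_intros | (unfold s6_val_simps s6_denom[OF gen_nonzero gen_nonzero gen_nonzero denom_nonzero(4)], rule s6_value[OF gen_nonzero gen_nonzero gen_nonzero denom_nonzero(4,5,6)])
      | (unfold s6_val_simps s6_denom[OF gen_nonzero gen_nonzero gen_nonzero denom_nonzero(4)], insert denom_nonzero, simp; fail)
      | (simp add: s6_val_simps denom_nonzero s6_denom; fail)
      | (simp add: s6_val_simps denom_nonzero s6_denom field_simps; fail)
      | (simp add: s6_val_simps denom_nonzero s6_denom divide_simps, simp add: algebra_simps power2_eq_square; fail))+
  done

lemma pi1_inverse: "has_value const pi1_val (pi1_val v) (gen v)"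
  apply (cases v; simp only: pi1_val_simps; rule has_value_eq)
  apply (rule value_intros | (unfold pi1_val_simps pi1_denom[OF gen_nonzero gen_nonzero gen_nonzero denom_nonzero(7)], rule pi1_value[OF gen_nonzero gen_nonzero gen_nonzero denom_nonzero(7,2,10)])
      | (unfold pi1_val_simps pi1_denom[OF gen_nonzero gen_nonzero gen_nonzero denom_nonzero(7)], insert denom_nonzero, simp; fail)
      | (simp add: pi1_val_simps denom_nonzero pi1_denom; fail)
      | (simp add: pi1_val_simps denom_nonzero pi1_denom field_simps; fail)
      | (simp add: pi1_val_simps denom_nonzero pi1_denom divide_simps, simp add: algebra_simps power2_eq_square; fail))+
  done

lemma pi2_inverse: "has_value const pi2_val (pi2_val v) (gen v)"
  apply (cases v; simp only: pi2_val_simps; rule has_value_eq)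
  apply (rule value_intros | (simp add: pi2_val_simps denom_nonzero ; fail)
      | (simp add: pi2_val_simps denom_nonzero  field_simps; fail)
      | (simp add: pi2_val_simps denom_nonzero  divide_simps, simp add: algebra_simps power2_eq_square; fail))+
  done

lemma q_value: "has_value const Xi_val q q" "has_value const Xi_inv_val q q"
proof -
  show "has_value const Xi_val q q"
    by (subst q_def, rule has_value_eq, (rule value_intros | (simp add: Xi_val_simps; fail))+,
      simp add: Xi_val_simps q_def field_simps, simp add: eval_nat_numeral)
  show "has_value const Xi_inv_val q q"
    by (subst q_def, rule has_value_eq, (rule value_intros | (simp add: Xi_inv_val_simps; fail))+,
      simp add: Xi_inv_val_simps q_def field_simps, simp add: eval_nat_numeral)
qed

lemma Xi_inverse: "has_value const Xi_inv_val (Xi_val v) (gen v)"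
  apply (cases v; simp only: Xi_val_simps; rule has_value_eq)
  apply (rule value_intros q_value | (simp add: Xi_inv_val_simps denom_nonzero ; fail)
      | (simp add: Xi_inv_val_simps denom_nonzero  field_simps; fail)
      | (simp add: Xi_inv_val_simps denom_nonzero  divide_simps, simp add: algebra_simps power2_eq_square; fail))+
  done

lemma Xi_inv_inverse: "has_value const Xi_val (Xi_inv_val v) (gen v)"
  apply (cases v; simp only: Xi_inv_val_simps; rule has_value_eq)
  apply (rule value_intros q_value | (simp add: Xi_val_simps denom_nonzero ; fail)
      | (simp add: Xi_val_simps denom_nonzero  field_simps; fail)
      | (simp add: Xi_val_simps power2_eq_square field_simps; fail)
      | (simp add: Xi_val_simps denom_nonzero  divide_simps, simp add: algebra_simps power2_eq_square; fail))+
  done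

lemma alg_aut_generators:
  shows "alg_aut s0" "alg_aut s1" "alg_aut s2" "alg_aut s3" "alg_aut s4" "alg_aut s5" "alg_aut s6"
    "alg_aut pi1" "alg_aut pi2"
  unfolding s0_def s1_def s2_def s3_def s4_def s5_def s6_def pi1_def pi2_def
  using swap_aut(1) s0_val_def s1_val_def s3_val_def s4_val_def s5_val_def
    hom_of_aut(1)[OF s2_inverse s2_inverse] hom_of_aut(1)[OF s6_inverse s6_inverse]
    hom_of_aut(1)[OF pi1_inverse pi1_inverse] hom_of_aut(1)[OF pi2_inverse pi2_inverse]
  by blast+

lemma alg_aut_Xi: "alg_aut Xi"
  unfolding Xi_def by (rule hom_of_aut(1)[OF Xi_inverse Xi_inv_inverse])

lemma generators_gen:
  shows "s0 (gen v) = s0_val v" "s1 (gen v) = s1_val v" "s2 (gen v) = s2_val v"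
    "s3 (gen v) = s3_val v" "s4 (gen v) = s4_val v" "s5 (gen v) = s5_val v"
    "s6 (gen v) = s6_val v" "pi1 (gen v) = pi1_val v" "pi2 (gen v) = pi2_val v"
  unfolding s0_def s1_def s2_def s3_def s4_def s5_def s6_def pi1_def pi2_def
  using swap_aut(2) s0_val_def s1_val_def s3_val_def s4_val_def s5_val_def
    hom_of_aut(2)[OF s2_inverse s2_inverse] hom_of_aut(2)[OF s6_inverse s6_inverse]
    hom_of_aut(2)[OF pi1_inverse pi1_inverse] hom_of_aut(2)[OF pi2_inverse pi2_inverse]
  by blast+

lemma Xi_gen: "Xi (gen v) = Xi_val v"
  unfolding Xi_def by (rule hom_of_aut(2)[OF Xi_inverse Xi_inv_inverse])

end

theory Submission
  imports Defs
begin

text \<open>\<open>T\<close> is \<open>\<Xi>\<close> times the square of a word \<open>W\<close>, and \<open>W\<close> is half of the time step: it maps \<open>f\<close> to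
  \<open>\<kappa>\<^sub>2 g\<close>, and the first equation of the time evolution holds with \<open>\<kappa>\<^sub>2 W g\<close> in place of \<open>T f\<close>.
  That equation is invariant under the equivalence of parameters, so applying \<open>\<Xi>\<close> to it yields the
  equation for \<open>T f\<close>, and applying \<open>\<Xi> W\<close> to it yields the equation for \<open>T g\<close>.  Uniqueness holds
  because the two equations are affine in \<open>1 / T f\<close> and \<open>1 / T g\<close>, with nonzero leading
  coefficients.\<close>

section \<open>Algebra homomorphisms and automorphisms of \<open>K\<close>\<close>

lemma
  assumes "alg_hom \<phi>"
  shows alg_hom_add: "\<phi> (x + y) = \<phi> x + \<phi> y"
    and alg_hom_mult: "\<phi> (x * y) = \<phi> x * \<phi> y"
    and alg_hom_zero: "\<phi> 0 = 0"
    and alg_hom_one: "\<phi> 1 = 1"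
    and alg_hom_diff: "\<phi> (x - y) = \<phi> x - \<phi> y"
    and alg_hom_eq_zero_iff: "\<phi> x = 0 \<longleftrightarrow> x = 0"
    and alg_hom_divide: "\<phi> (x / y) = \<phi> x / \<phi> y"
    and alg_hom_power: "\<phi> (x ^ n) = \<phi> x ^ n"
proof -
  show add: "\<phi> (x + y) = \<phi> x + \<phi> y" for x y
    using assms by (simp add: alg_hom_def)
  show mult: "\<phi> (x * y) = \<phi> x * \<phi> y" for x y
    using assms by (simp add: alg_hom_def)
  show zero: "\<phi> 0 = 0"
    using add[of 0 0] by (simp only: add_0_left add_cancel_right_right)
  show one: "\<phi> 1 = 1"
    using assms scalar_hom_const unfolding alg_hom_def scalar_hom_def by metis
  show "\<phi> (x - y) = \<phi> x - \<phi> y"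
    using add[of "x - y" y] by (simp add: eq_diff_eq)
  show eq0: "\<phi> x = 0 \<longleftrightarrow> x = 0" for x
    using mult[of x "inverse x"] zero one by (cases "x = 0") auto
  \<comment> \<open>For \<open>y = 0\<close> both sides are 0, because division by zero yields
    0.\<close>
  show "\<phi> (x / y) = \<phi> x / \<phi> y"
    using mult[of "x / y" y] zero eq0[of y] by (cases "y = 0") (simp_all add: eq_divide_eq)
  show "\<phi> (x ^ n) = \<phi> x ^ n"
    by (induction n) (simp_all add: one mult)
qed

lemmas alg_hom_simps =
  alg_hom_add alg_hom_mult alg_hom_zero alg_hom_one alg_hom_diff alg_hom_divide alg_hom_power

lemma alg_aut_imp_alg_hom: "alg_aut \<phi> \<Longrightarrow> alg_hom \<phi>"
  by (simp add: alg_aut_def)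

lemma alg_aut_comp: "alg_aut \<phi> \<Longrightarrow> alg_aut \<psi> \<Longrightarrow> alg_aut (\<phi> \<circ> \<psi>)"
  by (simp add: alg_aut_def alg_hom_def bij_comp)

lemma alg_aut_inv:
  assumes "alg_aut \<phi>"
  shows "\<phi> (inv \<phi> x) = x"
  using assms by (simp add: alg_aut_def bij_is_surj surj_f_inv_f)

lemmas alg_hom_generators = alg_aut_generators[THEN alg_aut_imp_alg_hom]
lemmas alg_hom_Xi = alg_aut_Xi[THEN alg_aut_imp_alg_hom]

lemmas generators_apply =
  generators_gen pi1_val_simps pi2_val_simps s6_val_simps s0_val_def s3_val_def s4_val_def s5_val_def
  alg_hom_generators[THEN alg_hom_add] alg_hom_generators[THEN alg_hom_mult]
  alg_hom_generators[THEN alg_hom_diff] alg_hom_generators[THEN alg_hom_divide]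
  alg_hom_generators[THEN alg_hom_one]

section \<open>The half step \<open>W\<close>\<close>

definition W :: "K \<Rightarrow> K" where
  "W = pi1 \<circ> pi2 \<circ> s4 \<circ> s5 \<circ> s3 \<circ> s6 \<circ> s4 \<circ> s3 \<circ> s0 \<circ> s6"

lemma alg_aut_W: "alg_aut W"
  unfolding W_def by (intro alg_aut_comp alg_aut_generators)

lemmas alg_hom_W = alg_aut_W[THEN alg_aut_imp_alg_hom]

lemma T_eq: "T x = Xi (W (W x))"
  by (simp add: T_def W_def[symmetric] numeral_2_eq_2)

text \<open>The value of \<open>W kappa2\<close> is \<open>q * nu7 * nu8 * kappa2 / kappa1\<close>
  with \<open>q\<close> written out. The remaining variable \<open>g\<close> is treated through its
  reciprocal in \<open>W_recip_g\<close>.\<close>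

lemma W_gen:
  "W nu1 = kappa2 / nu4" "W nu2 = kappa2 / nu3" "W nu3 = kappa2 / nu2" "W nu4 = kappa2 / nu1"
  "W nu5 = nu8" "W nu6 = nu7" "W nu7 = kappa2 / nu5" "W nu8 = kappa2 / nu6"
  "W kappa1 = kappa2"
  "W kappa2 = kappa1 * kappa2 ^ 3 / (nu1 * nu2 * nu3 * nu4 * nu5 * nu6)"
  "W f = kappa2 * g"
  by (simp_all add: W_def generators_apply field_simps power3_eq_cube)

text \<open>\<open>s6\<close> is affine in \<open>1 / g\<close>, so its two occurrences in \<open>W\<close> compose without fractions in the
  denominators.\<close>

lemma s6_recip_g:
  "1 / s6 g = ((kappa1 - nu7 * f) / g + (nu1 * nu7 - kappa1) * f) / (nu7 * (nu1 - f))"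
  using denom_nonzero(4,5)
  by (simp add: generators_gen s6_val_simps field_simps)

text \<open>The formula is the composite of two affine maps in the reciprocal of \<open>g\<close>,
  with \<open>1 / P g\<close> as its innermost fraction. It stays nested here; denominators are
  cleared only in \<open>half_step_identity\<close>.\<close>

lemma W_recip_g:
  "1 / W g = ((kappa2 - nu4 * (kappa2 * g)) *
       (((kappa2 - nu3 * (kappa2 * g)) *
           (kappa2 * (nu1 * nu2 * g + f - (nu1 + nu2) * f * g) / (nu1 * nu2 * (1 - f * g))) +
         (nu6 * nu3 - kappa2) * (kappa2 * g)) / (nu3 * (nu6 - kappa2 * g))) +
      (nu5 * nu4 - kappa2) * (kappa2 * g)) / (nu4 * (nu5 - kappa2 * g))"
proof -
  \<comment> \<open>\<open>P\<close> and \<open>R\<close> are the parts of \<open>W\<close> to the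
    left of its first and second \<open>s6\<close>. Since \<open>s4\<close>, \<open>s3\<close> and
    \<open>s0\<close> fix \<open>g\<close>, the reciprocal of \<open>R g\<close> is the image under
    \<open>P\<close> of that of \<open>s6 g\<close>.\<close>
  define P where "P = pi1 \<circ> pi2 \<circ> s4 \<circ> s5 \<circ> s3"
  define R where "R = P \<circ> s6 \<circ> s4 \<circ> s3 \<circ> s0"
  have P: "alg_hom P"
    unfolding P_def by (intro alg_aut_imp_alg_hom alg_aut_comp alg_aut_generators)
  have R: "alg_hom R"
    unfolding R_def P_def by (intro alg_aut_imp_alg_hom alg_aut_comp alg_aut_generators)
  have P_val: "P nu1 = nu6" "P nu7 = nu3" "P kappa1 = kappa2" "P f = kappa2 * g"
    "1 / P g = kappa2 * (nu1 * nu2 * g + f - (nu1 + nu2) * f * g) / (nu1 * nu2 * (1 - f * g))"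
    by (simp_all add: P_def generators_apply)
  have R_val: "R nu1 = nu5" "R nu7 = nu4" "R kappa1 = kappa2" "R f = kappa2 * g"
    by (simp_all add: R_def P_def generators_apply)
  have "R g = P (s6 g)"
    by (simp add: R_def generators_gen s0_val_def s3_val_def s4_val_def)
  then have "1 / R g = P (1 / s6 g)"
    by (simp add: alg_hom_simps[OF P])
  also have "\<dots> = ((P kappa1 - P nu7 * P f) * (1 / P g) + (P nu1 * P nu7 - P kappa1) * P f)
      / (P nu7 * (P nu1 - P f))"
    unfolding s6_recip_g by (simp add: alg_hom_simps[OF P])
  finally have R_g: "1 / R g = \<dots>" .
  have "W g = R (s6 g)"
    by (simp add: W_def R_def P_def)
  then have "1 / W g = R (1 / s6 g)"
    by (simp add: alg_hom_simps[OF R])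
  also have "\<dots> = ((R kappa1 - R nu7 * R f) * (1 / R g) + (R nu1 * R nu7 - R kappa1) * R f)
      / (R nu7 * (R nu1 - R f))"
    unfolding s6_recip_g by (simp add: alg_hom_simps[OF R])
  finally show ?thesis
    unfolding R_g R_val P_val by simp
qed

section \<open>The first evolution equation for the half step\<close>

lemma denom_nonzero_g:
  shows "nu5 - kappa2 * g \<noteq> 0" and "nu6 - kappa2 * g \<noteq> 0"
    and "g - nu5 / kappa2 \<noteq> 0" and "g - nu6 / kappa2 \<noteq> 0"
    and "g - 1 / nu1 \<noteq> 0" and "g - 1 / nu2 \<noteq> 0" and "g - 1 / nu3 \<noteq> 0" and "g - 1 / nu4 \<noteq> 0"
  \<comment> \<open>At the point where \<open>g\<close> is 3 and every other variable is 2, each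
    expression has a nonzero value.\<close>
  by - (rule has_value_nonzero[OF scalar_hom_id, where h = "(\<lambda>_. 2)(G := 3)"],
      (rule point_intros)+, (simp; fail)+)+

text \<open>Here \<open>a, b, c, d\<close> stand for \<open>nu1\<close> to \<open>nu4\<close>,
  \<open>m, n\<close> for \<open>nu5, nu6\<close>, \<open>l\<close> for \<open>kappa2\<close>,
  \<open>x, y\<close> for \<open>f, g\<close> and \<open>w\<close> for \<open>1 / W g\<close>. Once
  denominators are cleared, this is a polynomial identity.\<close>

lemma half_step_identity:
  fixes a b c d m n l x y w :: "'a :: field"
  assumes "a \<noteq> 0" "b \<noteq> 0" "c \<noteq> 0" "d \<noteq> 0" "l \<noteq> 0" "x \<noteq> 0"
    and "1 - x * y \<noteq> 0" "m - l * y \<noteq> 0" "n - l * y \<noteq> 0"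
    and w: "w = ((l - d * (l * y)) *
       (((l - c * (l * y)) * (l * (a * b * y + x - (a + b) * x * y) / (a * b * (1 - x * y))) +
         (n * c - l) * (l * y)) / (c * (n - l * y))) + (m * d - l) * (l * y)) / (d * (m - l * y))"
  shows "(x * y - 1) * (l * y - w) / (x * l) =
    (y - 1 / a) * (y - 1 / b) * (y - 1 / c) * (y - 1 / d) / ((y - m / l) * (y - n / l))"
proof -
  \<comment> \<open>Each factor becomes a single fraction, so that the denominators on the right are
    visibly the assumed nonzero expressions.\<close>
  have e: "y - 1 / a = (a * y - 1) / a" "y - 1 / b = (b * y - 1) / b" "y - 1 / c = (c * y - 1) / c"
    "y - 1 / d = (d * y - 1) / d" "y - m / l = - (m - l * y) / l" "y - n / l = - (n - l * y) / l"
    using assms by (simp_all add: field_simps)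
  show ?thesis
    unfolding e w using assms(1-9)
    by (simp add: divide_simps) (simp add: algebra_simps)
qed

lemma half_step:
  "(f * g - 1) * (kappa2 * W g * g - 1) / (f * (kappa2 * W g)) =
    (g - 1 / nu1) * (g - 1 / nu2) * (g - 1 / nu3) * (g - 1 / nu4)
      / ((g - nu5 / kappa2) * (g - nu6 / kappa2))"
proof -
  have "W g \<noteq> 0"
    by (simp add: alg_hom_eq_zero_iff[OF alg_hom_W])
  \<comment> \<open>Cancelling \<open>W g\<close> makes the left side affine in
    \<open>1 / W g\<close>.\<close>
  then have "(f * g - 1) * (kappa2 * W g * g - 1) / (f * (kappa2 * W g)) =
      (f * g - 1) * (kappa2 * g - 1 / W g) / (f * kappa2)"
    by (simp add: field_simps)
  also have "\<dots> = (g - 1 / nu1) * (g - 1 / nu2) * (g - 1 / nu3) * (g - 1 / nu4)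
      / ((g - nu5 / kappa2) * (g - nu6 / kappa2))"
    using denom_nonzero(8) denom_nonzero_g(1,2)
    by (intro half_step_identity[OF _ _ _ _ _ _ _ _ _ W_recip_g]) simp_all
  finally show ?thesis .
qed

section \<open>The values of \<open>T\<close> and the equations for \<open>T f\<close> and
  \<open>T g\<close>\<close>

lemma Xi_q: "Xi q = q"
  by (rule alg_hom_has_value[OF alg_hom_Xi Xi_gen q_value(1)])

lemmas Xi_apply = Xi_gen Xi_val_simps Xi_q alg_hom_simps[OF alg_hom_Xi]
lemmas W_apply = W_gen alg_hom_simps[OF alg_hom_W]

lemma Xi_W_kappa2: "Xi (W kappa2) = kappa1 / q"
  by (simp add: W_apply Xi_apply)
    (simp add: q_def field_simps power2_eq_square eval_nat_numeral)

text \<open>Since \<open>W f = kappa2 * g\<close>, the second application of \<open>W\<close> acts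
  on \<open>kappa2\<close> and \<open>g\<close> separately, and \<open>Xi_W_kappa2\<close> supplies
  the factor.\<close>

lemma T_f: "T f = kappa1 / q * Xi (W g)"
  by (simp add: T_eq W_gen(11) alg_hom_mult[OF alg_hom_W] alg_hom_mult[OF alg_hom_Xi] Xi_W_kappa2)

lemma T_gen:
  "T nu1 = nu1" "T nu2 = nu2" "T nu3 = nu3" "T nu4 = nu4"
  "T nu5 = nu5" "T nu6 = nu6" "T nu7 = nu7" "T nu8 = nu8"
  "T kappa1 = kappa1 / q" "T kappa2 = q * kappa2"
  by (simp_all add: T_eq W_apply Xi_apply)
    (simp_all add: q_def field_simps power2_eq_square eval_nat_numeral)

lemma alg_aut_T: "alg_aut T"
proof -
  have "T = Xi \<circ> (W \<circ> W)"
    by (simp add: fun_eq_iff T_eq)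
  then show ?thesis
    by (metis alg_aut_comp alg_aut_Xi alg_aut_W)
qed

lemmas alg_hom_T = alg_aut_T[THEN alg_aut_imp_alg_hom]

text \<open>The two kappas enter \<open>q\<close> only through their product, in which the factors
  \<open>1 / q\<close> and \<open>q\<close> cancel.\<close>

lemma T_q: "T q = q"
proof -
  have "T q = T kappa1 ^ 2 * T kappa2 ^ 2 /
      (T nu1 * T nu2 * T nu3 * T nu4 * T nu5 * T nu6 * T nu7 * T nu8)"
    by (simp add: q_def alg_hom_simps[OF alg_hom_T])
  also have "\<dots> = kappa1 ^ 2 * kappa2 ^ 2 / (nu1 * nu2 * nu3 * nu4 * nu5 * nu6 * nu7 * nu8)"
    unfolding T_gen by (simp add: power_mult_distrib power_divide)
  finally show ?thesis
    by (simp add: q_def)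
qed

lemma T_f_equation:
  "(f * g - 1) * (T f * g - 1) / (f * T f) =
    (g - 1 / nu1) * (g - 1 / nu2) * (g - 1 / nu3) * (g - 1 / nu4)
      / ((g - nu5 / kappa2) * (g - nu6 / kappa2))"
proof -
  \<comment> \<open>\<open>a\<close> is the factor by which \<open>Xi\<close> scales
    \<open>f\<close> and \<open>nu1\<close> to \<open>nu4\<close>. As \<open>Xi\<close> takes
    \<open>kappa2 * W g\<close> to \<open>a * T f\<close>, both sides of \<open>half_step\<close>
    acquire the factor \<open>1 / a ^ 2\<close>.\<close>
  define a where "a = nu5 * nu6 / kappa2"
  have a: "a \<noteq> 0"
    by (simp add: a_def)
  have Xi_values: "Xi f = a * f" "Xi g = g / a" "Xi kappa2 = a * (kappa1 / q)"
    "Xi nu1 = a * nu1" "Xi nu2 = a * nu2" "Xi nu3 = a * nu3" "Xi nu4 = a * nu4"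
    and Xi_ratios: "Xi nu5 / Xi kappa2 = nu5 / kappa2 / a" "Xi nu6 / Xi kappa2 = nu6 / kappa2 / a"
    by (simp_all add: a_def Xi_gen Xi_val_simps power2_eq_square mult_ac)
  have scaled: "g / a - 1 / (a * x) = (g - 1 / x) / a" for x
    by (simp add: diff_divide_distrib mult.commute)
  have "(f * g - 1) * (T f * g - 1) / (f * T f) =
      a ^ 2 * Xi ((f * g - 1) * (kappa2 * W g * g - 1) / (f * (kappa2 * W g)))"
    using a by (simp add: alg_hom_simps[OF alg_hom_Xi] Xi_values T_f power2_eq_square)
  also have "\<dots> = a ^ 2 * Xi ((g - 1 / nu1) * (g - 1 / nu2) * (g - 1 / nu3) * (g - 1 / nu4)
      / ((g - nu5 / kappa2) * (g - nu6 / kappa2)))"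
    unfolding half_step ..
  also have "\<dots> = a ^ 2 * ((g - 1 / nu1) / a * ((g - 1 / nu2) / a) * ((g - 1 / nu3) / a)
      * ((g - 1 / nu4) / a) / ((g - nu5 / kappa2) / a * ((g - nu6 / kappa2) / a)))"
    unfolding alg_hom_simps[OF alg_hom_Xi] Xi_ratios
    unfolding Xi_values scaled diff_divide_distrib[symmetric] ..
  also have "\<dots> = (g - 1 / nu1) * (g - 1 / nu2) * (g - 1 / nu3) * (g - 1 / nu4)
      / ((g - nu5 / kappa2) * (g - nu6 / kappa2))"
    using a by (simp add: power2_eq_square)
  finally show ?thesis .
qed

text \<open>Under \<open>Xi\<close> after \<open>W\<close>, the elements \<open>f\<close>,
  \<open>g\<close> and \<open>kappa2 * W g\<close> become \<open>c * g\<close>,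
  \<open>T f / c\<close> and \<open>c * T g\<close>, where \<open>c = kappa1 / q\<close>. The zeros
  \<open>1 / nu1\<close> to \<open>1 / nu4\<close> turn into \<open>nu4 / c\<close> to
  \<open>nu1 / c\<close>, and both sides of \<open>half_step\<close> acquire the factor
  \<open>1 / c ^ 2\<close>.\<close>

lemma T_g_equation:
  "(T f * g - 1) * (T f * T g - 1) / (g * T g) =
    (T f - nu1) * (T f - nu2) * (T f - nu3) * (T f - nu4)
      / ((T f - kappa1 / q / nu7) * (T f - kappa1 / q / nu8))"
proof -
  define c where "c = kappa1 / q"
  have c: "c \<noteq> 0"
    by (simp add: c_def)
  have Xi_W_values: "Xi (W f) = c * g" "Xi (W kappa2) = c" "Xi (W g) = T f / c"
    "1 / Xi (W nu1) = nu4 / c" "1 / Xi (W nu2) = nu3 / c"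
    "1 / Xi (W nu3) = nu2 / c" "1 / Xi (W nu4) = nu1 / c"
    "Xi (W nu5) = c / nu7" "Xi (W nu6) = c / nu8"
    by (simp_all add: Xi_W_kappa2 T_f c_def)
      (simp_all add: W_apply Xi_apply power2_eq_square)
  have "(T f * g - 1) * (T f * T g - 1) / (g * T g) =
      c ^ 2 * Xi (W ((f * g - 1) * (kappa2 * W g * g - 1) / (f * (kappa2 * W g))))"
    using c by (simp add: alg_hom_simps[OF alg_hom_W] alg_hom_simps[OF alg_hom_Xi] Xi_W_values
        T_eq[of g, symmetric] power2_eq_square mult_ac)
  also have "\<dots> = c ^ 2 * Xi (W ((g - 1 / nu1) * (g - 1 / nu2) * (g - 1 / nu3) * (g - 1 / nu4)
      / ((g - nu5 / kappa2) * (g - nu6 / kappa2))))"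
    unfolding half_step ..
  also have "\<dots> = c ^ 2 * ((T f - nu4) / c * ((T f - nu3) / c) * ((T f - nu2) / c)
      * ((T f - nu1) / c) / ((T f - c / nu7) / c * ((T f - c / nu8) / c)))"
    unfolding alg_hom_simps[OF alg_hom_W] alg_hom_simps[OF alg_hom_Xi] Xi_W_values
      diff_divide_distrib[symmetric] ..
  also have "\<dots> = (T f - nu1) * (T f - nu2) * (T f - nu3) * (T f - nu4)
      / ((T f - c / nu7) * (T f - c / nu8))"
    using c by (simp add: power2_eq_square)
  finally show ?thesis
    unfolding c_def .
qed

lemma is_time_evolution_T: "is_time_evolution T"
proof -
  \<comment> \<open>\<open>T\<close> maps \<open>inv T g\<close> to \<open>g\<close>, so the image
    of the second equation is \<open>T_g_equation\<close>; injectivity of \<open>T\<close> then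
    removes the outer \<open>T\<close>.\<close>
  have "T ((f * g - 1) * (f * inv T g - 1) / (g * inv T g)) =
      T ((f - nu1) * (f - nu2) * (f - nu3) * (f - nu4)
         / ((f - kappa1 / nu7) * (f - kappa1 / nu8)))"
    using T_g_equation
    by (simp add: alg_hom_simps[OF alg_hom_T] alg_aut_inv[OF alg_aut_T] T_gen(1-10) mult.commute)
  moreover have "inj T"
    using alg_aut_T by (simp add: alg_aut_def bij_is_inj)
  ultimately have "(f * g - 1) * (f * inv T g - 1) / (g * inv T g) =
      (f - nu1) * (f - nu2) * (f - nu3) * (f - nu4)
         / ((f - kappa1 / nu7) * (f - kappa1 / nu8))"
    by (simp add: inj_eq)
  then show ?thesis
    unfolding is_time_evolution_def using alg_aut_T T_q T_f_equation T_gen by blast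
qed

section \<open>Uniqueness of the time evolution\<close>

lemma recip_equation_unique:
  fixes x y z t c :: "'a :: field"
  assumes "c * (x * z - 1) / (t * x) = c * (y * z - 1) / (t * y)"
    and "c \<noteq> 0" "t \<noteq> 0" "x \<noteq> 0" "y \<noteq> 0"
  shows "x = y"
proof -
  \<comment> \<open>The two sides of the assumption are \<open>c / t\<close> times these
    differences.\<close>
  have "z - 1 / x = z - 1 / y"
    using assms by (simp add: field_simps)
  then show ?thesis
    by simp
qed

lemma is_time_evolution_unique:
  assumes "is_time_evolution \<phi>" and "is_time_evolution \<psi>"
  shows "\<phi> = \<psi>"
proof -
  have hom: "alg_hom \<phi>" "alg_hom \<psi>"
    using assms by (simp_all add: is_time_evolution_def alg_aut_imp_alg_hom)
  have nonzero: "\<phi> (gen v) \<noteq> 0" "\<psi> (gen v) \<noteq> 0" for v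
    by (simp_all add: hom alg_hom_eq_zero_iff)
  have f_eq: "(f * g - 1) * (\<theta> f * g - 1) / (f * \<theta> f) =
       (g - 1 / nu1) * (g - 1 / nu2) * (g - 1 / nu3) * (g - 1 / nu4)
         / ((g - nu5 / kappa2) * (g - nu6 / kappa2))" if "is_time_evolution \<theta>" for \<theta>
    using that by (simp add: is_time_evolution_def)
  have "f * g - 1 \<noteq> 0"
    using denom_nonzero(8) by simp
  then have f: "\<phi> f = \<psi> f"
    using recip_equation_unique[OF trans[OF f_eq[OF assms(1)] f_eq[OF assms(2), symmetric]]] nonzero
    by simp
  \<comment> \<open>Applying \<open>\<theta>\<close> to the second equation removes the inverse. The
    right side then involves only \<open>\<theta> f\<close>, on which both evolutions already
    agree.\<close>
  have g_eq: "(\<theta> f * g - 1) * (\<theta> g * \<theta> f - 1) / (g * \<theta> g) =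
      (\<theta> f - nu1) * (\<theta> f - nu2) * (\<theta> f - nu3) * (\<theta> f - nu4)
        / ((\<theta> f - kappa1 / q / nu7) * (\<theta> f - kappa1 / q / nu8))"
    if "is_time_evolution \<theta>" for \<theta>
  proof -
    have \<theta>: "alg_aut \<theta>" "alg_hom \<theta>"
      using that by (simp_all add: is_time_evolution_def alg_aut_imp_alg_hom)
    have "(f * g - 1) * (f * inv \<theta> g - 1) / (g * inv \<theta> g) =
       (f - nu1) * (f - nu2) * (f - nu3) * (f - nu4)
         / ((f - kappa1 / nu7) * (f - kappa1 / nu8))"
      using that by (simp add: is_time_evolution_def)
    from arg_cong[where f = \<theta>, OF this] show ?thesis
      using that
      by (simp add: is_time_evolution_def alg_hom_simps[OF \<theta>(2)] alg_aut_inv[OF \<theta>(1)] mult.commute)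
  qed
  \<comment> \<open>Otherwise the left side of the first equation would vanish, while its right side
    is a quotient of nonzero factors.\<close>
  have "\<phi> f * g - 1 \<noteq> 0"
    using f_eq[OF assms(1)] denom_nonzero_g by auto
  then have g: "\<phi> g = \<psi> g"
    using recip_equation_unique[OF trans[OF g_eq[OF assms(1)] g_eq[OF assms(2), folded f, symmetric]]]
      nonzero
    by simp
  have "\<phi> (gen v) = \<psi> (gen v)" for v
    using assms f g by (cases v) (simp_all add: is_time_evolution_def)
  then show ?thesis
    using hom by (rule alg_hom_unique[rotated -1])
qed

lemma equiv_E6_Xi: "equiv_E6 (\<lambda>v. Xi (gen v)) gen"
  unfolding equiv_E6_def
  \<comment> \<open>The witnesses are the factors by which \<open>Xi\<close> scales the blocks
    \<open>nu1\<close> to \<open>nu4\<close>, \<open>nu5, nu6\<close> and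
    \<open>nu7, nu8\<close>.\<close>
  by (rule exI[of _ "nu5 * nu6 / kappa2"], rule exI[of _ "kappa1 / (q * kappa2)"],
      rule exI[of _ "kappa1 / (q * nu7 * nu8)"])
    (simp add: Xi_gen Xi_val_simps power2_eq_square mult_ac)

theorem theorem3p2:
  shows "(\<exists>!\<phi>. is_time_evolution \<phi>)
    \<and> T = time_evolution
    \<and> (\<forall>v \<in> {N1, N2, N3, N4, N5, N6, N7, N8}. T (gen v) = gen v)
    \<and> T kappa1 = kappa1 / q
    \<and> T kappa2 = q * kappa2
    \<and> T q = q
    \<and> T f = time_evolution f
    \<and> T g = time_evolution g
    \<and> equiv_E6 (\<lambda>v. Xi (gen v)) gen"
proof -
  have "\<exists>!\<phi>. is_time_evolution \<phi>"
    using is_time_evolution_T is_time_evolution_unique by blast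
  moreover from this have "T = time_evolution"
    unfolding time_evolution_def using is_time_evolution_T by (metis the1_equality)
  ultimately show ?thesis
    using T_gen T_q equiv_E6_Xi by auto
qed

end
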